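(* Let $f:\mathbb{R}^n\to\mathbb{R}^n$ be a polynomial map and let $\mathbb{X}\subset\mathbb{R}^n$ be a compact basic semialgebraic set, $\mathbb{X}=\{x\in\mathbb{R}^n : \varphi_0(x)\ge 0\}$ with $\varphi_0:\mathbb{R}^n\to\mathbb{R}^m$ a polynomial map. Suppose that $f$ has a (not necessarily unique) fixed point $\bar{x}=f(\bar{x})$ which is locally asymptotically stable for $x^+=f(x)$ with basin of attraction $\Psi$, that $\bar{x}$ lies in the interior of $\mathbb{X}$, and that $\mathbb{X}\subseteq\Psi$. Then the maximal positively invariant set $\Omega_\infty$ for the dynamics $x^+=f(x)$ and the constraint set $\mathbb{X}$ is a (nonempty) compact and basic semialgebraic set.
   Context: $\mathbb{N}$ denotes the nonnegative integers. A map $g:\mathbb{R}^n\to\mathbb{R}^p$ is polynomial if each of its components is a polynomial in $n$ variables with real coefficients. Inequalities between vectors are componentwise. A set is basic semialgebraic if it is the solution set of a finite number of polynomial inequalities, i.e. of the form $\{x\in\mathbb{R}^n : \varphi(x)\ge 0\}$ for some polynomial map $\varphi:\mathbb{R}^n\to\mathbb{R}^p$ and some $p$. $f^k$ is the $k$-fold composition of $f$ with itself ($f^0$ the identity). A fixed point $\bar{x}$ is locally asymptotically stable if it is Lyapunov stable (for every $\epsilon>0$ there is $\delta>0$ such that $\|x-\bar{x}\|<\delta$ implies $\|f^k(x)-\bar{x}\|<\epsilon$ for all $k\in\mathbb{N}$) and locally attractive ($f^k(x)\to\bar{x}$ for all $x$ in some neighborhood of $\bar{x}$). Its basin of attraction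 is $\Psi=\{x\in\mathbb{R}^n : f^k(x)\to\bar{x}\text{ as }k\to\infty\}$. A set $\Omega\subseteq\mathbb{R}^n$ is positively invariant (for the dynamics $x^+=f(x)$ and constraint set $\mathbb{X}$) if $\Omega\subseteq\mathbb{X}$ and $f(x)\in\Omega$ for all $x\in\Omega$. The maximal positively invariant set $\Omega_\infty$ is the positively invariant set that contains all positively invariant sets. *)

theory Defs
  imports "HOL-Analysis.Analysis"
begin

text \<open>
  Polynomial maps between Euclidean spaces are \<^const>\<open>polynomial_function\<close> and real polynomials
  in the coordinates are \<^const>\<open>real_polynomial_function\<close>. The next lemma confirms that the former
  means that every component is a polynomial.
\<close>

lemma polynomial_function_iff_components:
  fixes f :: "'a::real_normed_vector \<Rightarrow> real ^ 'm"
  shows "polynomial_function f \<longleftrightarrow> (\<forall>i. real_polynomial_function (\<lambda>x. f x $ i))"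
  by (auto simp: polynomial_function_iff_Basis_inner Basis_vec_def inner_axis)

text \<open>
  The number of inequalities is existentially quantified, so it cannot be the dimension of a
  type; a polynomial map into the space of dimension \<open>p\<close> is given here by the family of its
  components \<open>\<phi> 0, \<dots>, \<phi> (p - 1)\<close>.
\<close>

definition basic_semialgebraic :: "(real ^ 'n) set \<Rightarrow> bool" where
  "basic_semialgebraic S \<longleftrightarrow>
     (\<exists>(p::nat) (\<phi> :: nat \<Rightarrow> real ^ 'n \<Rightarrow> real).
        (\<forall>i<p. real_polynomial_function (\<phi> i)) \<and> S = {x. \<forall>i<p. \<phi> i x \<ge> 0})"

definition lyapunov_stable :: "('a::real_normed_vector \<Rightarrow> 'a) \<Rightarrow> 'a \<Rightarrow> bool" where
  "lyapunov_stable f xb \<longleftrightarrow>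
     (\<forall>\<epsilon>>0. \<exists>\<delta>>0. \<forall>x. norm (x - xb) < \<delta> \<longrightarrow> (\<forall>k. norm ((f ^^ k) x - xb) < \<epsilon>))"

definition basin_of_attraction :: "('a::real_normed_vector \<Rightarrow> 'a) \<Rightarrow> 'a \<Rightarrow> 'a set" where
  "basin_of_attraction f xb = {x. (\<lambda>k. (f ^^ k) x) \<longlonglongrightarrow> xb}"

definition locally_attractive :: "('a::real_normed_vector \<Rightarrow> 'a) \<Rightarrow> 'a \<Rightarrow> bool" where
  "locally_attractive f xb \<longleftrightarrow>
     (\<exists>U. open U \<and> xb \<in> U \<and> (\<forall>x\<in>U. (\<lambda>k. (f ^^ k) x) \<longlonglongrightarrow> xb))"

definition locally_asymptotically_stable :: "('a::real_normed_vector \<Rightarrow> 'a) \<Rightarrow> 'a \<Rightarrow> bool" where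
  "locally_asymptotically_stable f xb \<longleftrightarrow> lyapunov_stable f xb \<and> locally_attractive f xb"

definition positively_invariant :: "('a \<Rightarrow> 'a) \<Rightarrow> 'a set \<Rightarrow> 'a set \<Rightarrow> bool" where
  "positively_invariant f X \<Omega> \<longleftrightarrow> \<Omega> \<subseteq> X \<and> (\<forall>x\<in>\<Omega>. f x \<in> \<Omega>)"

definition max_positively_invariant :: "('a \<Rightarrow> 'a) \<Rightarrow> 'a set \<Rightarrow> 'a set" where
  "max_positively_invariant f X =
     (THE \<Omega>. positively_invariant f X \<Omega> \<and> (\<forall>\<Omega>'. positively_invariant f X \<Omega>' \<longrightarrow> \<Omega>' \<subseteq> \<Omega>))"

text \<open>The definite description above always denotes.\<close>

lemma ex1_max_positively_invariant:
  "\<exists>!\<Omega>. positively_invariant f X \<Omega> \<and> (\<forall>\<Omega>'. positively_invariant f X \<Omega>' \<longrightarrow> \<Omega>' \<subseteq> \<Omega>)"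
proof (rule ex1I)
  let ?U = "\<Union>{\<Omega>. positively_invariant f X \<Omega>}"
  show "positively_invariant f X ?U \<and> (\<forall>\<Omega>'. positively_invariant f X \<Omega>' \<longrightarrow> \<Omega>' \<subseteq> ?U)"
    unfolding positively_invariant_def by blast
  then show "\<Omega> = ?U"
    if "positively_invariant f X \<Omega> \<and> (\<forall>\<Omega>'. positively_invariant f X \<Omega>' \<longrightarrow> \<Omega>' \<subseteq> \<Omega>)" for \<Omega>
    using that by (intro subset_antisym) blast+
qed

end

theory Submission
  imports Defs
begin

text \<open>
  The maximal positively invariant set consists of the points of \<open>X\<close> whose whole orbit stays in
  \<open>X\<close>; it is cut out by the infinitely many conditions \<open>(f ^^ k) x \<in> X\<close>. Each condition is a finite system
  of polynomial inequalities in \<open>x\<close>, so the set is basic semialgebraic once finitely many of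
  them imply all the others.

  They do because Lyapunov stability gives a ball \<open>B\<close> around the equilibrium, which is interior
  to \<open>X\<close>, such that an orbit that has entered \<open>B\<close> never leaves \<open>X\<close> again. Every orbit from \<open>X\<close>
  converges to the equilibrium and therefore enters \<open>B\<close>. As the
  iterates are continuous, \<open>X\<close> is covered by the open sets of points that are in \<open>B\<close> at time \<open>k\<close>,
  and compactness of \<open>X\<close> bounds the entrance time by a number \<open>N\<close> common to all points of \<open>X\<close>
  (lemma \<open>uniform_entrance_time\<close>). An orbit that stays in \<open>X\<close> up to time \<open>N\<close> has entered \<open>B\<close> by
  then and stays in \<open>X\<close> forever.
\<close>

lemma max_positively_invariant_eq:
  "max_positively_invariant f X = {x. \<forall>k. (f ^^ k) x \<in> X}"
proof -
  have invariant: "positively_invariant f X {x. \<forall>k. (f ^^ k) x \<in> X}"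
    unfolding positively_invariant_def
  proof safe
    fix x assume orbit: "\<forall>k. (f ^^ k) x \<in> X"
    show "x \<in> X" using orbit[rule_format, of 0] by simp
    show "(f ^^ k) (f x) \<in> X" for k
      using orbit[rule_format, of "Suc k"] by (simp add: funpow_swap1)
  qed
  have largest: "\<Omega> \<subseteq> {x. \<forall>k. (f ^^ k) x \<in> X}" if "positively_invariant f X \<Omega>" for \<Omega>
  proof safe
    fix x k assume "x \<in> \<Omega>"
    have "(f ^^ k) x \<in> \<Omega>"
      using \<open>x \<in> \<Omega>\<close> that by (induction k) (auto simp: positively_invariant_def)
    then show "(f ^^ k) x \<in> X"
      using that by (auto simp: positively_invariant_def)
  qed
  show ?thesis
    unfolding max_positively_invariant_def
    using invariant largest
    by (intro the1_equality[OF ex1_max_positively_invariant]) blast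
qed

lemma continuous_on_funpow:
  fixes f :: "'a::topological_space \<Rightarrow> 'a"
  assumes "continuous_on UNIV f"
  shows "continuous_on UNIV (f ^^ k)"
proof (induction k)
  case 0
  show ?case by (simp add: id_def)
next
  case (Suc k)
  then show ?case
    unfolding funpow.simps
    by (rule continuous_on_compose) (rule continuous_on_subset[OF assms subset_UNIV])
qed

text \<open>
  The points that are in \<open>U\<close> at time \<open>k\<close> form an open set, and these sets cover \<open>X\<close>; \<open>N\<close> is the
  largest index of a finite subcover.
\<close>

lemma uniform_entrance_time:
  fixes f :: "'a::real_normed_vector \<Rightarrow> 'a"
  assumes "continuous_on UNIV f" "compact X" "X \<subseteq> basin_of_attraction f xb"
    and "open U" "xb \<in> U"
  obtains N where "\<And>x. x \<in> X \<Longrightarrow> \<exists>k\<le>N. (f ^^ k) x \<in> U"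
proof -
  have "open ((f ^^ k) -` U)" for k
    using continuous_on_funpow[OF assms(1)] \<open>open U\<close> by (simp add: open_vimage)
  moreover have "X \<subseteq> (\<Union>k. (f ^^ k) -` U)"
  proof
    fix x assume "x \<in> X"
    then have "(\<lambda>k. (f ^^ k) x) \<longlonglongrightarrow> xb"
      using assms(3) by (auto simp: basin_of_attraction_def)
    then have "eventually (\<lambda>k. (f ^^ k) x \<in> U) sequentially"
      using \<open>open U\<close> \<open>xb \<in> U\<close> by (rule topological_tendstoD)
    then show "x \<in> (\<Union>k. (f ^^ k) -` U)"
      by (auto simp: eventually_sequentially)
  qed
  ultimately obtain K where "finite K" and K: "X \<subseteq> (\<Union>k\<in>K. (f ^^ k) -` U)"
    by (rule compactE_image[OF \<open>compact X\<close>])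
  obtain N where "\<forall>k\<in>K. k \<le> N"
    using \<open>finite K\<close> finite_nat_set_iff_bounded_le by blast
  then show thesis using K that by blast
qed

text \<open>
  Past the uniform entrance time into a ball from which no orbit leaves \<open>X\<close>, the constraints hold
  automatically.
\<close>

lemma orbit_in_compact_finitely_determined:
  fixes f :: "'a::real_normed_vector \<Rightarrow> 'a"
  assumes "continuous_on UNIV f" "compact X" "lyapunov_stable f xb" "xb \<in> interior X"
    and "X \<subseteq> basin_of_attraction f xb"
  obtains N where "{x. \<forall>k. (f ^^ k) x \<in> X} = {x. \<forall>k\<le>N. (f ^^ k) x \<in> X}"
proof -
  obtain \<epsilon> where "\<epsilon> > 0" and \<epsilon>: "ball xb \<epsilon> \<subseteq> X"
    using assms(4) by (auto simp: mem_interior)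
  obtain \<delta> where "\<delta> > 0"
    and \<delta>: "\<And>y k. norm (y - xb) < \<delta> \<Longrightarrow> norm ((f ^^ k) y - xb) < \<epsilon>"
    using assms(3) \<open>\<epsilon> > 0\<close> unfolding lyapunov_stable_def by blast
  have stays: "(f ^^ k) y \<in> X" if "y \<in> ball xb \<delta>" for y k
    using \<delta>[of y k] \<epsilon> that by (auto simp: dist_norm norm_minus_commute)
  obtain N where N: "\<And>x. x \<in> X \<Longrightarrow> \<exists>k\<le>N. (f ^^ k) x \<in> ball xb \<delta>"
    using uniform_entrance_time[OF assms(1,2,5) open_ball centre_in_ball[THEN iffD2, OF \<open>\<delta> > 0\<close>]]
    by blast
  have "(f ^^ j) x \<in> X" if early: "\<forall>k\<le>N. (f ^^ k) x \<in> X" for x j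
  proof (cases "j \<le> N")
    case True
    then show ?thesis using early by blast
  next
    case False
    have "x \<in> X" using early[rule_format, of 0] by simp
    then obtain k where "k \<le> N" and k: "(f ^^ k) x \<in> ball xb \<delta>"
      using N by blast
    have "(f ^^ j) x = (f ^^ (j - k)) ((f ^^ k) x)"
      using False \<open>k \<le> N\<close> funpow_add[of "j - k" k f] by simp
    then show ?thesis using stays[OF k] by simp
  qed
  then show thesis by (intro that[of N]) auto
qed

lemma closed_basic_semialgebraic:
  assumes "basic_semialgebraic S"
  shows "closed S"
proof -
  obtain p \<phi> where \<phi>: "\<forall>i<(p::nat). real_polynomial_function (\<phi> i)"
    and S: "S = {x. \<forall>i<p. \<phi> i x \<ge> 0}"
    using assms unfolding basic_semialgebraic_def by blast
  have "closed {x. 0 \<le> \<phi> i x}" if "i < p" for i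
    using \<phi> that
    by (intro closed_Collect_le continuous_intros continuous_on_polymonial_function)
       (simp add: real_polynomial_function_eq)
  then have "closed (\<Inter>i\<in>{..<p}. {x. 0 \<le> \<phi> i x})"
    by blast
  also have "(\<Inter>i\<in>{..<p}. {x. 0 \<le> \<phi> i x}) = S"
    using S by auto
  finally show ?thesis .
qed

lemma basic_semialgebraic_UNIV: "basic_semialgebraic UNIV"
  unfolding basic_semialgebraic_def by (rule exI[of _ 0]) simp

lemma basic_semialgebraic_Int:
  assumes "basic_semialgebraic S" "basic_semialgebraic T"
  shows "basic_semialgebraic (S \<inter> T)"
proof -
  obtain p \<phi> where \<phi>: "\<forall>i<(p::nat). real_polynomial_function (\<phi> i)"
    and S: "S = {x. \<forall>i<p. \<phi> i x \<ge> 0}"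
    using assms(1) unfolding basic_semialgebraic_def by blast
  obtain q \<psi> where \<psi>: "\<forall>i<(q::nat). real_polynomial_function (\<psi> i)"
    and T: "T = {x. \<forall>i<q. \<psi> i x \<ge> 0}"
    using assms(2) unfolding basic_semialgebraic_def by blast
  define \<theta> where "\<theta> j = (if j < p then \<phi> j else \<psi> (j - p))" for j
  have split: "(\<forall>j<p + q. P (\<theta> j)) \<longleftrightarrow> (\<forall>i<p. P (\<phi> i)) \<and> (\<forall>i<q. P (\<psi> i))" for P
  proof safe
    assume all: "\<forall>j<p + q. P (\<theta> j)"
    show "P (\<phi> i)" if "i < p" for i
      using all[rule_format, of i] that by (simp add: \<theta>_def)
    show "P (\<psi> i)" if "i < q" for i
      using all[rule_format, of "p + i"] that by (simp add: \<theta>_def)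
  qed (simp add: \<theta>_def)
  have "\<forall>j<p + q. real_polynomial_function (\<theta> j)"
    using \<phi> \<psi> by (simp add: split)
  moreover have "S \<inter> T = {x. \<forall>j<p + q. \<theta> j x \<ge> 0}"
    unfolding S T using split[of "\<lambda>g. g x \<ge> 0" for x] by auto
  ultimately show ?thesis
    unfolding basic_semialgebraic_def by blast
qed

lemma basic_semialgebraic_vimage:
  assumes "polynomial_function g" "basic_semialgebraic S"
  shows "basic_semialgebraic (g -` S)"
proof -
  obtain p \<phi> where \<phi>: "\<forall>i<(p::nat). real_polynomial_function (\<phi> i)"
    and S: "S = {x. \<forall>i<p. \<phi> i x \<ge> 0}"
    using assms(2) unfolding basic_semialgebraic_def by blast
  have "\<forall>i<p. real_polynomial_function (\<phi> i \<circ> g)"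
    using \<phi> assms(1) by (blast intro: real_polynomial_function_compose)
  moreover have "g -` S = {x. \<forall>i<p. (\<phi> i \<circ> g) x \<ge> 0}"
    by (auto simp: S)
  ultimately show ?thesis
    unfolding basic_semialgebraic_def
    by (intro exI[of _ p] exI[of _ "\<lambda>i. \<phi> i \<circ> g"] conjI)
qed

lemma polynomial_function_funpow:
  fixes f :: "'a::euclidean_space \<Rightarrow> 'a"
  assumes "polynomial_function f"
  shows "polynomial_function (f ^^ k)"
proof (induction k)
  case 0
  show ?case by (simp add: id_def)
next
  case (Suc k)
  then show ?case
    unfolding funpow.simps using assms by (rule polynomial_function_compose)
qed

lemma basic_semialgebraic_orbit_segment:
  fixes f :: "real ^ 'n \<Rightarrow> real ^ 'n"
  assumes "polynomial_function f" "basic_semialgebraic X"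
  shows "basic_semialgebraic {x. \<forall>k\<le>N. (f ^^ k) x \<in> X}"
proof -
  have "basic_semialgebraic {x. \<forall>k<M. (f ^^ k) x \<in> X}" for M
  proof (induction M)
    case 0
    show ?case by (simp add: basic_semialgebraic_UNIV)
  next
    case (Suc M)
    have "{x. \<forall>k<Suc M. (f ^^ k) x \<in> X} = {x. \<forall>k<M. (f ^^ k) x \<in> X} \<inter> (f ^^ M) -` X"
      by (auto simp: less_Suc_eq)
    with Suc show ?case
      using basic_semialgebraic_vimage[OF polynomial_function_funpow[OF assms(1)] assms(2)]
      by (simp add: basic_semialgebraic_Int)
  qed
  from this[of "Suc N"] show ?thesis by (simp add: less_Suc_eq_le)
qed

theorem corollary12:
  fixes f :: "real ^ 'n \<Rightarrow> real ^ 'n"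
    and X :: "(real ^ 'n) set"
    and m :: nat
    and \<phi>\<^sub>0 :: "nat \<Rightarrow> real ^ 'n \<Rightarrow> real"
    and xb :: "real ^ 'n"
  assumes "polynomial_function f"
    and "\<forall>i<m. real_polynomial_function (\<phi>\<^sub>0 i)"
    and "X = {x. \<forall>i<m. \<phi>\<^sub>0 i x \<ge> 0}"
    and "compact X"
    and "f xb = xb"
    and "locally_asymptotically_stable f xb"
    and "xb \<in> interior X"
    and "X \<subseteq> basin_of_attraction f xb"
  shows "max_positively_invariant f X \<noteq> {} \<and>
         compact (max_positively_invariant f X) \<and>
         basic_semialgebraic (max_positively_invariant f X)"
proof (intro conjI)
  let ?\<Omega> = "max_positively_invariant f X"
  have "(f ^^ k) xb = xb" for k
    by (induction k) (simp_all add: assms(5))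
  then have "xb \<in> ?\<Omega>"
    using assms(7) interior_subset by (auto simp: max_positively_invariant_eq)
  then show "?\<Omega> \<noteq> {}" by blast
  have "continuous_on UNIV f"
    using assms(1) by (rule continuous_on_polymonial_function)
  moreover have "lyapunov_stable f xb"
    using assms(6) by (simp add: locally_asymptotically_stable_def)
  ultimately obtain N where "?\<Omega> = {x. \<forall>k\<le>N. (f ^^ k) x \<in> X}"
    unfolding max_positively_invariant_eq
    by (rule orbit_in_compact_finitely_determined[OF _ assms(4) _ assms(7,8)])
  moreover have "basic_semialgebraic X"
    using assms(2,3) unfolding basic_semialgebraic_def by blast
  ultimately show semialgebraic: "basic_semialgebraic ?\<Omega>"
    using basic_semialgebraic_orbit_segment[OF assms(1)] by simp
  have "?\<Omega> \<subseteq> X"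
    unfolding max_positively_invariant_eq by (auto dest: spec[of _ 0])
  then show "compact ?\<Omega>"
    using compact_Int_closed[OF assms(4) closed_basic_semialgebraic[OF semialgebraic]]
    by (simp add: Int_absorb1)
qed

end
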